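(* Let $(X,d)$ be a complete metric space, let $\psi\colon[0,\infty)\to[0,\infty)$ be a function that is continuous at $0$ with $\psi(0)=0$, and let $T\colon X\to X$ be a mapping such that, for some $0\le\alpha<1$, $$d(Tx,Ty)+\psi(d(Tx,Ty))\le\alpha\,\big(d(x,y)+\psi(d(x,y))\big)\quad\text{for all }x,y\in X.$$ Then $T$ is a Picard operator on $(X,d)$.
   Context: $X$ is a nonempty set. A self-mapping $T$ of a metric space $(X,d)$ is called a Picard operator if $T$ has a unique fixed point $u\in X$ and for every $x\in X$ the sequence of iterates $(T^n x)$ converges to $u$ in $(X,d)$. *)

theory Defs
  imports "HOL-Analysis.Analysis"
begin

definition (in Metric_space) picard_operator :: "('a \<Rightarrow> 'a) \<Rightarrow> bool" where
  "picard_operator T \<longleftrightarrow>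
     T \<in> M \<rightarrow> M \<and>
     (\<exists>u\<in>M. T u = u \<and> (\<forall>v\<in>M. T v = v \<longrightarrow> v = u) \<and>
        (\<forall>x\<in>M. limitin mtopology (\<lambda>n. (T ^^ n) x) u sequentially))"

end

theory Submission
  imports Defs
begin

text \<open>
  Put \<open>g t = t + \<psi> t\<close>, so that \<open>g t \<ge> t\<close> and \<open>g (d (T x) (T y)) \<le> \<alpha> * g (d x y)\<close>. Then
  \<open>d (T\<^sup>n x) (T\<^sup>n y) \<le> \<alpha>\<^sup>n * g (d x y)\<close>, and summing the geometric series over consecutive iterates
  shows that orbits are Cauchy. Continuity of \<open>\<psi>\<close> at \<open>0\<close> makes \<open>T\<close> sequentially
  continuous, so that the limit of an orbit is a fixed point, and the geometric estimate with \<open>y\<close>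
  a fixed point gives uniqueness and convergence of all orbits.
\<close>

locale modified_contraction = Metric_space M d
  for M :: "'a set" and d :: "'a \<Rightarrow> 'a \<Rightarrow> real" +
  fixes \<psi> :: "real \<Rightarrow> real" and T :: "'a \<Rightarrow> 'a" and \<alpha> :: real
  assumes psi_nonneg: "t \<ge> 0 \<Longrightarrow> \<psi> t \<ge> 0"
    and maps: "T \<in> M \<rightarrow> M"
    and alpha_nonneg: "0 \<le> \<alpha>" and alpha_less_1: "\<alpha> < 1"
    and contraction: "x \<in> M \<Longrightarrow> y \<in> M \<Longrightarrow>
      d (T x) (T y) + \<psi> (d (T x) (T y)) \<le> \<alpha> * (d x y + \<psi> (d x y))"
begin

lemma funpow_in: "x \<in> M \<Longrightarrow> (T ^^ n) x \<in> M"
  using maps by (induction n) auto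

text \<open>The induction runs on the whole quantity \<open>t + \<psi> t\<close>: the contraction
  condition has the same expression on both sides and so can be iterated, whereas a bound on
  \<open>d\<close> alone could not be fed back into it.\<close>

lemma gauge_funpow_le:
  assumes "x \<in> M" "y \<in> M"
  shows "d ((T ^^ n) x) ((T ^^ n) y) + \<psi> (d ((T ^^ n) x) ((T ^^ n) y))
    \<le> \<alpha> ^ n * (d x y + \<psi> (d x y))"
proof (induction n)
  case (Suc n)
  let ?x = "(T ^^ n) x" and ?y = "(T ^^ n) y"
  have "d (T ?x) (T ?y) + \<psi> (d (T ?x) (T ?y)) \<le> \<alpha> * (d ?x ?y + \<psi> (d ?x ?y))"
    using assms by (intro contraction funpow_in)
  also have "\<dots> \<le> \<alpha> * (\<alpha> ^ n * (d x y + \<psi> (d x y)))"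
    using Suc alpha_nonneg by (rule mult_left_mono)
  finally show ?case by (simp add: mult.assoc)
qed simp

lemma dist_funpow_le:
  assumes "x \<in> M" "y \<in> M"
  shows "d ((T ^^ n) x) ((T ^^ n) y) \<le> \<alpha> ^ n * (d x y + \<psi> (d x y))"
  using gauge_funpow_le[OF assms, of n] psi_nonneg[of "d ((T ^^ n) x) ((T ^^ n) y)"] by simp

lemma geometric_tendsto_0: "(\<lambda>n. \<alpha> ^ n * c) \<longlonglongrightarrow> 0"
  using alpha_nonneg alpha_less_1 by (intro tendsto_mult_left_zero LIMSEQ_power_zero) simp

text \<open>Any two orbits merge. With a fixed point as \<open>y\<close> this gives convergence of
  every orbit to it; with two fixed points it gives their equality.\<close>

lemma dist_funpow_tendsto_0:
  assumes "x \<in> M" "y \<in> M"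
  shows "(\<lambda>n. d ((T ^^ n) x) ((T ^^ n) y)) \<longlonglongrightarrow> 0"
  by (rule tendsto_sandwich[OF _ _ tendsto_const geometric_tendsto_0[of "d x y + \<psi> (d x y)"]])
    (use dist_funpow_le[OF assms] in auto)

text \<open>The triangle inequality along the orbit bounds the distance by the sum of
  \<open>\<alpha> ^ (n + i)\<close> over \<open>i < k\<close>, times a constant. The closed form of
  this sum is used, multiplied through by \<open>1 - \<alpha>\<close> to avoid division.\<close>

lemma dist_orbit_le:
  assumes x: "x \<in> M"
  shows "(1 - \<alpha>) * d ((T ^^ n) x) ((T ^^ (n + k)) x)
    \<le> \<alpha> ^ n * (1 - \<alpha> ^ k) * (d x (T x) + \<psi> (d x (T x)))"
proof (induction k)
  case 0
  then show ?case using funpow_in[OF x] by simp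
next
  case (Suc k)
  let ?C = "d x (T x) + \<psi> (d x (T x))"
  have "T x \<in> M" using maps x by auto
  \<comment> \<open>Consecutive iterates are the images of the pair \<open>x\<close>,
    \<open>T x\<close> under one power of \<open>T\<close>.\<close>
  then have step: "d ((T ^^ (n + k)) x) ((T ^^ (n + Suc k)) x) \<le> \<alpha> ^ (n + k) * ?C"
    using dist_funpow_le[of x "T x" "n + k"] x by (simp add: funpow_swap1)
  have "d ((T ^^ n) x) ((T ^^ (n + Suc k)) x)
      \<le> d ((T ^^ n) x) ((T ^^ (n + k)) x) + d ((T ^^ (n + k)) x) ((T ^^ (n + Suc k)) x)"
    using x by (intro triangle funpow_in)
  also have "\<dots> \<le> d ((T ^^ n) x) ((T ^^ (n + k)) x) + \<alpha> ^ (n + k) * ?C"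
    using step by simp
  finally have "(1 - \<alpha>) * d ((T ^^ n) x) ((T ^^ (n + Suc k)) x)
      \<le> (1 - \<alpha>) * (d ((T ^^ n) x) ((T ^^ (n + k)) x) + \<alpha> ^ (n + k) * ?C)"
    using alpha_less_1 by (intro mult_left_mono) simp_all
  also have "\<dots> = (1 - \<alpha>) * d ((T ^^ n) x) ((T ^^ (n + k)) x) + (1 - \<alpha>) * (\<alpha> ^ (n + k) * ?C)"
    by (rule distrib_left)
  also have "\<dots> \<le> \<alpha> ^ n * (1 - \<alpha> ^ k) * ?C + (1 - \<alpha>) * (\<alpha> ^ (n + k) * ?C)"
    using Suc by simp
  also have "\<dots> = \<alpha> ^ n * (1 - \<alpha> ^ Suc k) * ?C"
    by (simp add: power_add algebra_simps)
  finally show ?case .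
qed

text \<open>Estimating \<open>1 - \<alpha> ^ k\<close> by 1 in \<open>dist_orbit_le\<close> leaves a
  bound that does not depend on the later index and tends to 0 in the earlier one.\<close>

lemma MCauchy_orbit:
  assumes x: "x \<in> M"
  shows "MCauchy (\<lambda>n. (T ^^ n) x)"
proof -
  define C where "C = d x (T x) + \<psi> (d x (T x))"
  have C: "C \<ge> 0" using psi_nonneg[of "d x (T x)"] by (simp add: C_def)
  have bound: "(1 - \<alpha>) * d ((T ^^ n) x) ((T ^^ n') x) \<le> \<alpha> ^ n * C" if "n \<le> n'" for n n'
  proof -
    have "(1 - \<alpha>) * d ((T ^^ n) x) ((T ^^ n') x) \<le> \<alpha> ^ n * (1 - \<alpha> ^ (n' - n)) * C"
      using dist_orbit_le[OF x, of n "n' - n"] that by (simp add: C_def)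
    also have "\<dots> \<le> \<alpha> ^ n * 1 * C"
      using alpha_nonneg C by (intro mult_right_mono mult_left_mono) simp_all
    finally show ?thesis by simp
  qed
  have "\<exists>N. \<forall>n n'. N \<le> n \<longrightarrow> N \<le> n' \<longrightarrow> d ((T ^^ n) x) ((T ^^ n') x) < e" if "e > 0" for e
  proof -
    \<comment> \<open>The tolerance is scaled by \<open>1 - \<alpha> > 0\<close> because
      \<open>bound\<close> controls the distance multiplied by that factor.\<close>
    have "\<forall>\<^sub>F n in sequentially. \<alpha> ^ n * C < (1 - \<alpha>) * e"
      using order_tendstoD(2)[OF geometric_tendsto_0] that alpha_less_1 by simp
    then obtain N where N: "\<And>n. n \<ge> N \<Longrightarrow> \<alpha> ^ n * C < (1 - \<alpha>) * e"
      by (auto simp: eventually_sequentially)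
    have less: "d ((T ^^ n) x) ((T ^^ n') x) < e" if "N \<le> n" "n \<le> n'" for n n'
    proof -
      have "(1 - \<alpha>) * d ((T ^^ n) x) ((T ^^ n') x) < (1 - \<alpha>) * e"
        using bound[OF \<open>n \<le> n'\<close>] N[OF \<open>N \<le> n\<close>] by (rule order.strict_trans1)
      then show ?thesis using alpha_less_1 by simp
    qed
    have "d ((T ^^ n) x) ((T ^^ n') x) < e" if "N \<le> n" "N \<le> n'" for n n'
      using less[of n n'] less[of n' n] that commute by (cases "n \<le> n'") auto
    then show ?thesis by blast
  qed
  then show ?thesis
    using funpow_in[OF x] by (auto simp: MCauchy_def)
qed

text \<open>The contraction condition bounds the distance of the images by
  \<open>\<alpha> * (t + \<psi> t)\<close> at \<open>t = d (\<sigma> n) u\<close>, and this tends to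
  0 with \<open>t\<close> by continuity of \<open>\<psi>\<close> at 0.\<close>

lemma limitin_image:
  assumes cont: "continuous (at 0 within {0..}) \<psi>" and "\<psi> 0 = 0"
    and \<sigma>: "limitin mtopology \<sigma> u sequentially" "range \<sigma> \<subseteq> M"
  shows "limitin mtopology (\<lambda>n. T (\<sigma> n)) (T u) sequentially"
proof -
  have u: "u \<in> M" and lim: "(\<lambda>n. d (\<sigma> n) u) \<longlonglongrightarrow> 0"
    using \<sigma>(1) by (auto simp: limitin_metric_dist_null)
  \<comment> \<open>Distances lie in \<open>{0..}\<close>, so one-sided continuity at 0
    applies.\<close>
  have "(\<lambda>n. \<psi> (d (\<sigma> n) u)) \<longlonglongrightarrow> \<psi> 0"
    using cont _ lim by (rule continuous_within_tendsto_compose') simp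
  then have "(\<lambda>n. \<alpha> * (d (\<sigma> n) u + \<psi> (d (\<sigma> n) u))) \<longlonglongrightarrow> \<alpha> * (0 + 0)"
    using lim unfolding \<open>\<psi> 0 = 0\<close> by (intro tendsto_mult_left tendsto_add)
  then have gauge: "(\<lambda>n. \<alpha> * (d (\<sigma> n) u + \<psi> (d (\<sigma> n) u))) \<longlonglongrightarrow> 0"
    by simp
  have in_M: "\<sigma> n \<in> M" for n using \<sigma>(2) by blast
  have le: "d (T (\<sigma> n)) (T u) \<le> \<alpha> * (d (\<sigma> n) u + \<psi> (d (\<sigma> n) u))" for n
    using contraction[OF in_M[of n] u] psi_nonneg[of "d (T (\<sigma> n)) (T u)"] by simp
  have "(\<lambda>n. d (T (\<sigma> n)) (T u)) \<longlonglongrightarrow> 0"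
    by (rule tendsto_sandwich[OF _ _ tendsto_const gauge]) (use le in auto)
  then show ?thesis
    using funcset_mem[OF maps] in_M u by (simp add: limitin_metric_dist_null)
qed

lemma picard_operator:
  assumes "M \<noteq> {}" "mcomplete"
    and "continuous (at 0 within {0..}) \<psi>" "\<psi> 0 = 0"
  shows "picard_operator T"
proof -
  obtain a where a: "a \<in> M" using \<open>M \<noteq> {}\<close> by blast
  obtain u where lim: "limitin mtopology (\<lambda>n. (T ^^ n) a) u sequentially"
    using \<open>mcomplete\<close> MCauchy_orbit[OF a] by (auto simp: mcomplete_def)
  have u: "u \<in> M" using lim by (simp add: limitin_metric)
  \<comment> \<open>The shifted orbit converges both to \<open>T u\<close>, as the image of the
    orbit, and to \<open>u\<close>, as its tail; limits in a metric space are unique.\<close>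
  have "limitin mtopology (\<lambda>n. (T ^^ Suc n) a) (T u) sequentially"
    using limitin_image[OF assms(3,4) lim] funpow_in[OF a] by auto
  moreover have "limitin mtopology (\<lambda>n. (T ^^ Suc n) a) u sequentially"
    using limitin_sequentially_offset[OF lim, of 1] by simp
  ultimately have "T u = u"
    by (intro limitin_metric_unique) auto
  then have iter_u: "(T ^^ n) u = u" for n by (induction n) auto
  have conv: "limitin mtopology (\<lambda>n. (T ^^ n) x) u sequentially" if "x \<in> M" for x
    using dist_funpow_tendsto_0[OF that u] funpow_in[OF that] u
    by (simp add: limitin_metric_dist_null iter_u)
  have "v = u" if "v \<in> M" "T v = v" for v
  proof -
    have "(T ^^ n) v = v" for n using \<open>T v = v\<close> by (induction n) auto
    \<comment> \<open>Iterating \<open>T\<close> moves neither \<open>v\<close> nor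
      \<open>u\<close>, so the distances that tend to 0 form a constant sequence.\<close>
    then have "(\<lambda>n. d v u) \<longlonglongrightarrow> 0"
      using dist_funpow_tendsto_0[OF \<open>v \<in> M\<close> u] by (simp add: iter_u)
    then show ?thesis using \<open>v \<in> M\<close> u by (simp add: LIMSEQ_const_iff)
  qed
  then show ?thesis
    unfolding picard_operator_def using maps u \<open>T u = u\<close> conv by blast
qed

end

theorem corollary3p7:
  fixes X :: "'a set" and d :: "'a \<Rightarrow> 'a \<Rightarrow> real"
    and \<psi> :: "real \<Rightarrow> real" and T :: "'a \<Rightarrow> 'a" and \<alpha> :: real
  assumes "X \<noteq> {}"
    and "Metric_space X d"
    and "Metric_space.mcomplete X d"
    and "\<And>t. t \<ge> 0 \<Longrightarrow> \<psi> t \<ge> 0"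
    and "continuous (at 0 within {0..}) \<psi>"
    and "\<psi> 0 = 0"
    and "T \<in> X \<rightarrow> X"
    and "0 \<le> \<alpha>" and "\<alpha> < 1"
    and "\<And>x y. x \<in> X \<Longrightarrow> y \<in> X \<Longrightarrow>
           d (T x) (T y) + \<psi> (d (T x) (T y)) \<le> \<alpha> * (d x y + \<psi> (d x y))"
  shows "Metric_space.picard_operator X d T"
proof -
  interpret Metric_space X d by fact
  interpret modified_contraction X d \<psi> T \<alpha>
    by unfold_locales (fact assms)+
  show ?thesis
    by (rule picard_operator) fact+
qed

end
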